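(* Let $f\in\mathcal{A}_C(\mathbb{R}^+)$. The Laplace transform $\widehat f(z)=\int_0^\infty f(t)e^{-zt}\,dt$ exists for all $z\in\mathbb{C}$ with $\mathrm{Re}\,z>0$ and for $z=0$. On the half plane $\mathrm{Re}\,z>0$, $\widehat f$ is (complex) differentiable to all orders, and for all $n\in\mathbb{N}$ $$\frac{d^n\widehat f(z)}{dz^n}=(-1)^n\int_0^\infty f(t)\,t^ne^{-zt}\,dt.$$
   Context: $\mathbb{R}^+=(0,\infty)$. $\mathcal{A}_C(\mathbb{R}^+)$ is the set of distributions $f\in\mathcal{D}'(\mathbb{R}^+)$ (dual of $C_c^\infty((0,\infty))$, real-valued) such that $f=F'$ (distributional derivative, $\langle F',\phi\rangle=-\int_0^\infty F\phi'$) for some real function $F$ continuous on $[0,\infty]$ (i.e. continuous on $[0,\infty)$ with $F(\infty)=\lim_{x\to\infty}F(x)$ existing in $\mathbb{R}$) with $F(0)=0$; such $F$ is unique and is called the primitive of $f$. If $g:[0,\infty]\to\mathbb{R}$ is of bounded variation, then $\int_0^\infty fg=\int_0^\infty f(t)g(t)\,dt:=F(\infty)g(\infty)-\int_0^\infty F\,dg$ (Riemann–Stieltjes integral over $[0,\infty]$). A complex-valued $g$ is of bounded variation if its real and imaginary parts are, and the integral is then defined by linearity. Functions of bounded variation on $[0,\infty)$, such as $t\mapsto t^ne^{-zt}$ with $\mathrm{Re}\,z>0$, are extended to $[0,\infty]$ by their limit at $\infty$. The integral exists when $g$ is of bounded variation on $[0,\infty]$. *)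

theory Defs
  imports "HOL-Analysis.Analysis"
begin

section \<open>Test functions and distributions on the open half line\<close>

text \<open>A test function on \<open>(0,\<infinity>)\<close> is represented by its extension by zero to the real line, so
  that smoothness can be stated with \<^const>\<open>deriv\<close>. A functional is a total function on
  \<open>real \<Rightarrow> real\<close>, but only its values on test functions are ever used.\<close>

definition test_functions :: "(real \<Rightarrow> real) set" where
  "test_functions = {\<phi>. (\<forall>k x. (deriv ^^ k) \<phi> field_differentiable at x) \<and>
     (\<exists>K. compact K \<and> K \<subseteq> {0<..} \<and> (\<forall>x. x \<notin> K \<longrightarrow> \<phi> x = 0))}"

definition test_converges :: "(nat \<Rightarrow> real \<Rightarrow> real) \<Rightarrow> (real \<Rightarrow> real) \<Rightarrow> bool" where
  "test_converges \<Phi> \<phi> \<longleftrightarrow>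
     (\<forall>m. \<Phi> m \<in> test_functions) \<and> \<phi> \<in> test_functions \<and>
     (\<exists>K. compact K \<and> K \<subseteq> {0<..} \<and> (\<forall>m x. x \<notin> K \<longrightarrow> \<Phi> m x = 0)) \<and>
     (\<forall>k. uniform_limit UNIV (\<lambda>m. (deriv ^^ k) (\<Phi> m)) ((deriv ^^ k) \<phi>) sequentially)"

definition distribution :: "((real \<Rightarrow> real) \<Rightarrow> real) \<Rightarrow> bool" where
  "distribution T \<longleftrightarrow>
     (\<forall>\<phi>\<in>test_functions. \<forall>\<psi>\<in>test_functions. \<forall>a b.
        T (\<lambda>x. a * \<phi> x + b * \<psi> x) = a * T \<phi> + b * T \<psi>) \<and>
     (\<forall>\<Phi> \<phi>. test_converges \<Phi> \<phi> \<longrightarrow> (\<lambda>m. T (\<Phi> m)) \<longlonglongrightarrow> T \<phi>)"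

text \<open>Functions on \<open>[0,\<infinity>]\<close> have domain type \<^typ>\<open>ereal\<close>; their values outside
  \<open>{0..\<infinity>}\<close> are irrelevant.\<close>

definition is_AC_primitive :: "((real \<Rightarrow> real) \<Rightarrow> real) \<Rightarrow> (ereal \<Rightarrow> real) \<Rightarrow> bool" where
  "is_AC_primitive f F \<longleftrightarrow> continuous_on {0..\<infinity>} F \<and> F 0 = 0 \<and>
     (\<forall>\<phi>\<in>test_functions. f \<phi> = - integral {0..} (\<lambda>t. F (ereal t) * deriv \<phi> t))"

definition AC_distributions :: "((real \<Rightarrow> real) \<Rightarrow> real) set" where
  "AC_distributions = {f. distribution f \<and> (\<exists>F. is_AC_primitive f F)}"

text \<open>The primitive is unique on \<open>[0,\<infinity>]\<close> but arbitrary on the rest of \<^typ>\<open>ereal\<close>, hence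
  \<open>SOME\<close> rather than \<open>THE\<close>.\<close>

definition AC_primitive :: "((real \<Rightarrow> real) \<Rightarrow> real) \<Rightarrow> ereal \<Rightarrow> real" where
  "AC_primitive f = (SOME F. is_AC_primitive f F)"


section \<open>Bounded variation and the Riemann--Stieltjes integral\<close>

definition partition_points :: "'a::linorder \<Rightarrow> 'a \<Rightarrow> nat \<Rightarrow> (nat \<Rightarrow> 'a) \<Rightarrow> bool" where
  "partition_points a b n x \<longleftrightarrow> x 0 = a \<and> x n = b \<and> (\<forall>i<n. x i < x (Suc i))"

definition bounded_variation_on_interval ::
    "'a::linorder \<Rightarrow> 'a \<Rightarrow> ('a \<Rightarrow> real) \<Rightarrow> bool" where
  "bounded_variation_on_interval a b g \<longleftrightarrow>
     (\<exists>M. \<forall>n x. partition_points a b n x \<longrightarrow> (\<Sum>i<n. \<bar>g (x (Suc i)) - g (x i)\<bar>) \<le> M)"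

text \<open>The limit is taken along refinement of partitions, which makes sense on \<open>[0,\<infinity>]\<close>,
  where there is no canonical notion of mesh.\<close>

definition has_RS_integral ::
    "('a::linorder \<Rightarrow> real) \<Rightarrow> ('a \<Rightarrow> real) \<Rightarrow> 'a \<Rightarrow> 'a \<Rightarrow> real \<Rightarrow> bool" where
  "has_RS_integral F g a b J \<longleftrightarrow>
     (\<forall>\<epsilon>>0. \<exists>m y. partition_points a b m y \<and>
        (\<forall>n x c. partition_points a b n x \<and> y ` {..m} \<subseteq> x ` {..n} \<and>
            (\<forall>i<n. c i \<in> {x i..x (Suc i)}) \<longrightarrow>
          \<bar>(\<Sum>i<n. F (c i) * (g (x (Suc i)) - g (x i))) - J\<bar> < \<epsilon>))"


section \<open>The integral of a distribution against a multiplier of bounded variation\<close>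

definition has_AC_integral_real ::
    "((real \<Rightarrow> real) \<Rightarrow> real) \<Rightarrow> (ereal \<Rightarrow> real) \<Rightarrow> real \<Rightarrow> bool" where
  "has_AC_integral_real f g I \<longleftrightarrow> bounded_variation_on_interval 0 \<infinity> g \<and>
     (\<exists>J. has_RS_integral (AC_primitive f) g 0 \<infinity> J \<and> I = AC_primitive f \<infinity> * g \<infinity> - J)"

definition has_AC_integral ::
    "((real \<Rightarrow> real) \<Rightarrow> real) \<Rightarrow> (ereal \<Rightarrow> complex) \<Rightarrow> complex \<Rightarrow> bool" where
  "has_AC_integral f g I \<longleftrightarrow>
     has_AC_integral_real f (\<lambda>x. Re (g x)) (Re I) \<and>
     has_AC_integral_real f (\<lambda>x. Im (g x)) (Im I)"

definition AC_integrable :: "((real \<Rightarrow> real) \<Rightarrow> real) \<Rightarrow> (ereal \<Rightarrow> complex) \<Rightarrow> bool" where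
  "AC_integrable f g \<longleftrightarrow> (\<exists>I. has_AC_integral f g I)"

definition AC_integral :: "((real \<Rightarrow> real) \<Rightarrow> real) \<Rightarrow> (ereal \<Rightarrow> complex) \<Rightarrow> complex" where
  "AC_integral f g = (THE I. has_AC_integral f g I)"

definition extend_at_infinity :: "(real \<Rightarrow> complex) \<Rightarrow> ereal \<Rightarrow> complex" where
  "extend_at_infinity g x = (if x = \<infinity> then Lim at_top g else g (real_of_ereal x))"

definition laplace_transform :: "((real \<Rightarrow> real) \<Rightarrow> real) \<Rightarrow> complex \<Rightarrow> complex" where
  "laplace_transform f z = AC_integral f (extend_at_infinity (\<lambda>t. exp (- z * of_real t)))"

end

theory Submission
  imports Defs
begin

text \<open>
  Let \<open>F\<close> be the primitive of \<open>f\<close>. If the multiplier \<open>g\<close> has an absolutely integrable derivative,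
  the Riemann--Stieltjes integral of \<open>F\<close> with respect to \<open>g\<close> is the Lebesgue integral of \<open>F g'\<close>:
  choose a partition of \<open>[0,\<infinity>]\<close> on whose pieces \<open>F\<close> oscillates by less than \<open>\<delta>\<close>; then the sums
  over all its refinements are within \<open>\<delta> \<integral>\<bar>g'\<bar>\<close> of it. With \<open>L\<^sub>n(z) = \<integral> F(t) t\<^sup>n e\<^bsup>-zt\<^esup> dt\<close>, which
  converges absolutely for \<open>Re z > 0\<close> since \<open>F\<close> is bounded, this gives
  \<open>\<integral> f(t) t\<^sup>n e\<^bsup>-zt\<^esup> dt = z L\<^sub>n(z) - n L\<^bsub>n-1\<^esub>(z)\<close>. A quadratic Taylor estimate under the integral
  shows \<open>L\<^sub>n' = -L\<^bsub>n+1\<^esub>\<close>, so the derivative of \<open>z L\<^sub>n - n L\<^bsub>n-1\<^esub>\<close> is \<open>-(z L\<^bsub>n+1\<^esub> - (n+1) L\<^sub>n)\<close>.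
\<close>

section \<open>Partitions and the Riemann--Stieltjes integral\<close>


lemma partition_points_mono:
  assumes "partition_points a b n x" "i \<le> j" "j \<le> n"
  shows "x i \<le> x j"
  using assms(2,3)
proof (induction j rule: dec_induct)
  case (step k)
  then have "x k < x (Suc k)"
    using assms(1) by (simp add: partition_points_def)
  with step show ?case by simp
qed simp

lemma partition_points_bounds:
  assumes "partition_points a b n x" "i \<le> n"
  shows "a \<le> x i" "x i \<le> b"
  using partition_points_mono[OF assms(1), of 0 i] partition_points_mono[OF assms(1), of i n] assms
  by (auto simp: partition_points_def)

text \<open>Sorting the set puts its points in strict order, and the bounds force the first and last
  entries to be \<open>a\<close> and \<open>b\<close>. Refinements can thus be built from their
  point sets alone.\<close>

lemma partition_points_of_finite_set:
  fixes A :: "'a::linorder set"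
  assumes "finite A" "a \<in> A" "b \<in> A" "\<And>x. x \<in> A \<Longrightarrow> a \<le> x \<and> x \<le> b"
  obtains n x where "partition_points a b n x" "x ` {..n} = A"
proof -
  define xs where "xs = sorted_list_of_set A"
  define n where "n = length xs - 1"
  have set_xs: "set xs = A" and sorted: "sorted_wrt (<) xs"
    using assms(1) by (auto simp: xs_def)
  have ne: "xs \<noteq> []" using set_xs assms(2) by auto
  then have len: "length xs = Suc n" by (simp add: n_def)
  have img: "(!) xs ` {..n} = A"
    using set_xs by (auto simp: len set_conv_nth less_Suc_eq_le image_def)
  have le: "xs ! i \<le> xs ! j" if "i \<le> j" "j \<le> n" for i j
    using that len sorted_nth_mono[of xs i j] by (simp add: xs_def)
  have "xs ! 0 = a"
  proof -
    obtain i where "i \<le> n" "xs ! i = a" using img assms(2) by (metis atMost_iff imageE)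
    with le[of 0 i] assms(4)[of "xs ! 0"] img show ?thesis by force
  qed
  moreover have "xs ! n = b"
  proof -
    obtain i where "i \<le> n" "xs ! i = b" using img assms(3) by (metis atMost_iff imageE)
    with le[of i n] assms(4)[of "xs ! n"] img show ?thesis by force
  qed
  moreover have "\<forall>i<n. xs ! i < xs ! Suc i"
    using sorted len by (auto simp: sorted_wrt_iff_nth_less)
  ultimately have "partition_points a b n ((!) xs)"
    by (simp add: partition_points_def)
  then show thesis using img by (rule that)
qed

lemma partition_points_common_refinement:
  assumes "partition_points a b m y" "partition_points a b m' y'"
  obtains n x where "partition_points a b n x" "y ` {..m} \<subseteq> x ` {..n}" "y' ` {..m'} \<subseteq> x ` {..n}"
proof -
  let ?A = "y ` {..m} \<union> y' ` {..m'}"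
  have "a \<in> ?A" "b \<in> ?A" using assms by (auto simp: partition_points_def)
  moreover have "a \<le> x \<and> x \<le> b" if "x \<in> ?A" for x
    using that partition_points_bounds[OF assms(1)] partition_points_bounds[OF assms(2)] by auto
  ultimately obtain n x where "partition_points a b n x" "x ` {..n} = ?A"
    using partition_points_of_finite_set[of ?A a b] by blast
  then show thesis using that by blast
qed

text \<open>Partitions are directed under refinement: a sum over a common refinement would lie
  within half of \<open>\<bar>J - J'\<bar>\<close> of both values.\<close>

lemma has_RS_integral_unique:
  assumes "has_RS_integral F g a b J" "has_RS_integral F g a b J'"
  shows "J = J'"
proof (rule ccontr)
  assume "J \<noteq> J'"
  define \<epsilon> where "\<epsilon> = \<bar>J - J'\<bar> / 2"
  have "\<epsilon> > 0" using \<open>J \<noteq> J'\<close> by (simp add: \<epsilon>_def)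
  let ?S = "\<lambda>n x c. \<Sum>i<n. F (c i) * (g (x (Suc i)) - g (x i))"
  obtain m y where y: "partition_points a b m y"
    "\<forall>n x c. partition_points a b n x \<and> y ` {..m} \<subseteq> x ` {..n} \<and>
       (\<forall>i<n. c i \<in> {x i..x (Suc i)}) \<longrightarrow> \<bar>?S n x c - J\<bar> < \<epsilon>"
    using assms(1)[unfolded has_RS_integral_def, rule_format, OF \<open>\<epsilon> > 0\<close>] by (elim exE conjE)
  obtain m' y' where y': "partition_points a b m' y'"
    "\<forall>n x c. partition_points a b n x \<and> y' ` {..m'} \<subseteq> x ` {..n} \<and>
       (\<forall>i<n. c i \<in> {x i..x (Suc i)}) \<longrightarrow> \<bar>?S n x c - J'\<bar> < \<epsilon>"
    using assms(2)[unfolded has_RS_integral_def, rule_format, OF \<open>\<epsilon> > 0\<close>] by (elim exE conjE)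
  obtain n x where x: "partition_points a b n x" "y ` {..m} \<subseteq> x ` {..n}" "y' ` {..m'} \<subseteq> x ` {..n}"
    using partition_points_common_refinement[OF y(1) y'(1)] .
  \<comment> \<open>Left endpoints serve as tags, so \<open>x\<close> is its own tag
    sequence.\<close>
  have tags: "\<forall>i<n. x i \<in> {x i..x (Suc i)}"
    using x(1) by (auto simp: partition_points_def intro: less_imp_le)
  have "\<bar>?S n x x - J\<bar> < \<epsilon>" "\<bar>?S n x x - J'\<bar> < \<epsilon>"
    using y(2)[rule_format, OF conjI[OF x(1) conjI[OF x(2) tags]]]
      y'(2)[rule_format, OF conjI[OF x(1) conjI[OF x(3) tags]]] .
  then show False
    using abs_triangle_ineq4[of "?S n x x - J'" "?S n x x - J"] unfolding \<epsilon>_def by simp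
qed

text \<open>No point of \<open>y\<close> lies strictly inside a piece of the refinement
  \<open>x\<close>, so each piece is caught between the last point of \<open>y\<close> not beyond
  \<open>x i\<close> and its successor. This carries oscillation bounds from \<open>y\<close> to all
  its refinements.\<close>

lemma partition_points_refinement_interval:
  assumes y: "partition_points a b m y" and x: "partition_points a b n x"
    and sub: "y ` {..m} \<subseteq> x ` {..n}" and "i < n"
  obtains j where "j < m" "y j \<le> x i" "x (Suc i) \<le> y (Suc j)"
proof -
  define j where "j = (GREATEST j. j \<le> m \<and> y j \<le> x i)"
  have "0 \<le> m \<and> y 0 \<le> x i"
    using partition_points_bounds(1)[OF x, of i] \<open>i < n\<close> y by (auto simp: partition_points_def)
  then have j: "j \<le> m \<and> y j \<le> x i" and max: "\<And>k. k \<le> m \<and> y k \<le> x i \<Longrightarrow> k \<le> j"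
    unfolding j_def
    by (rule GreatestI_nat[where b = m], simp) (rule Greatest_le_nat[where b = m], auto)
  have "x i < x (Suc i)" "x (Suc i) \<le> b"
    using x \<open>i < n\<close> partition_points_bounds(2)[OF x, of "Suc i"] by (auto simp: partition_points_def)
  then have "j \<noteq> m" using j y by (auto simp: partition_points_def)
  with j have "j < m" by simp
  with max[of "Suc j"] have less: "x i < y (Suc j)" by force
  obtain k where k: "k \<le> n" "y (Suc j) = x k"
    using sub \<open>j < m\<close> by (metis (no_types, lifting) Suc_leI atMost_iff image_iff image_subset_iff)
  have "i < k"
    using less k partition_points_mono[OF x, of k i] \<open>i < n\<close> by (metis leD less_imp_le not_le)
  then have "x (Suc i) \<le> y (Suc j)"
    using partition_points_mono[OF x, of "Suc i" k] k by simp
  with that \<open>j < m\<close> j show thesis by blast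
qed

text \<open>Continuity at \<infinity> settles a tail \<open>[T, \<infinity>]\<close>, and uniform
  continuity settles the compact interval \<open>[0, T]\<close>.\<close>

lemma small_oscillation_partition:
  fixes F :: "ereal \<Rightarrow> real"
  assumes cont: "continuous_on {0..\<infinity>} F" and "\<epsilon> > 0"
  obtains m y where "partition_points 0 \<infinity> m y"
    "\<And>j s t. j < m \<Longrightarrow> s \<in> {y j..y (Suc j)} \<Longrightarrow> t \<in> {y j..y (Suc j)} \<Longrightarrow> \<bar>F s - F t\<bar> < \<epsilon>"
proof -
  have "open (ball (F \<infinity>) (\<epsilon>/2))" "F \<infinity> \<in> ball (F \<infinity>) (\<epsilon>/2)" using \<open>\<epsilon> > 0\<close> by auto
  moreover have "\<infinity> \<in> {0..\<infinity>::ereal}" by simp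
  ultimately obtain A where A: "open A" "\<infinity> \<in> A" "\<And>t. t \<in> {0..\<infinity>} \<Longrightarrow> t \<in> A \<Longrightarrow> F t \<in> ball (F \<infinity>) (\<epsilon>/2)"
    using cont unfolding continuous_on_topological by metis
  obtain T0 where T0: "{ereal T0<..} \<subseteq> A"
    using open_PInfty[OF A(1,2)] by auto
  \<comment> \<open>The summand 1 makes \<open>T\<close> positive and larger than \<open>T0\<close>,
    so the closed tail from \<open>T\<close> lies in \<open>A\<close>.\<close>
  define T where "T = max T0 0 + 1"
  have "T > 0" "T > T0" by (auto simp: T_def)
  have tail: "\<bar>F s - F t\<bar> < \<epsilon>" if "s \<ge> ereal T" "t \<ge> ereal T" for s t
  proof -
    have "r \<in> {0..\<infinity>} \<and> r \<in> A" if "r \<ge> ereal T" for r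
      using that \<open>T > T0\<close> \<open>T > 0\<close> T0
      by (cases r) auto
    then have "F s \<in> ball (F \<infinity>) (\<epsilon>/2)" "F t \<in> ball (F \<infinity>) (\<epsilon>/2)"
      using A(3) that by blast+
    then show ?thesis unfolding mem_ball dist_real_def by linarith
  qed
  have "continuous_on {0..T} (\<lambda>t. F (ereal t))"
    by (rule continuous_on_compose2[OF cont]) (auto intro!: continuous_intros)
  then have "uniformly_continuous_on {0..T} (\<lambda>t. F (ereal t))"
    by (intro compact_uniformly_continuous) auto
  then obtain \<delta> where "\<delta> > 0"
    and \<delta>: "\<And>s t. s \<in> {0..T} \<Longrightarrow> t \<in> {0..T} \<Longrightarrow> \<bar>s - t\<bar> < \<delta> \<Longrightarrow> \<bar>F (ereal s) - F (ereal t)\<bar> < \<epsilon>"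
    unfolding uniformly_continuous_on_def dist_real_def using \<open>\<epsilon> > 0\<close> by metis
  obtain N where N: "T < real N * \<delta>"
    using reals_Archimedean3[OF \<open>\<delta> > 0\<close>] by blast
  have "N > 0" using N \<open>T > 0\<close> by (cases N) auto
  \<comment> \<open>There are \<open>N\<close> pieces of length \<open>T / N < \<delta>\<close> and
    one last piece \<open>[T, \<infinity>]\<close>, hence \<open>Suc N\<close> pieces.\<close>
  define y where "y j = (if j \<le> N then ereal (T * real j / real N) else \<infinity>)" for j
  show thesis
  proof (rule that[of "Suc N" y])
    show "partition_points 0 \<infinity> (Suc N) y"
      using \<open>T > 0\<close> \<open>N > 0\<close>
      by (auto simp: partition_points_def y_def divide_strict_right_mono zero_ereal_def)
  next
    fix j s t
    assume j: "j < Suc N" and st: "s \<in> {y j..y (Suc j)}" "t \<in> {y j..y (Suc j)}"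
    show "\<bar>F s - F t\<bar> < \<epsilon>"
    proof (cases "j = N")
      case True
      then show ?thesis using st \<open>N > 0\<close> by (intro tail) (auto simp: y_def)
    next
      case False
      define l u where "l = T * real j / real N" and "u = T * real (Suc j) / real N"
      have yl: "y j = ereal l" "y (Suc j) = ereal u"
        using j False by (auto simp: y_def l_def u_def)
      have "0 \<le> l" using \<open>T > 0\<close> by (simp add: l_def)
      have "u \<le> T"
      proof -
        have "T * real (Suc j) \<le> T * real N" using j False \<open>T > 0\<close> by (intro mult_left_mono) auto
        then show ?thesis using \<open>N > 0\<close> by (simp add: u_def divide_le_eq)
      qed
      have "u - l = T / real N"
        by (simp add: u_def l_def diff_divide_distrib[symmetric] algebra_simps)
      also have "\<dots> < \<delta>" using N \<open>N > 0\<close> by (simp add: divide_less_eq mult.commute)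
      finally have "u - l < \<delta>" .
      obtain s' t' where "s = ereal s'" "t = ereal t'"
        using st yl by (cases s; cases t) auto
      then show ?thesis
        using st yl \<delta>[of s' t'] \<open>0 \<le> l\<close> \<open>u \<le> T\<close> \<open>u - l < \<delta>\<close> by auto
    qed
  qed
qed

section \<open>Lebesgue integrals along partitions\<close>

lemma interval_lebesgue_integral_partition:
  fixes h :: "real \<Rightarrow> 'a::{banach, second_countable_topology}"
  assumes x: "partition_points a b n x" and h: "set_integrable lborel (einterval a b) h"
  shows "(\<Sum>i<n. LBINT t=x i..x (Suc i). h t) = (LBINT t=a..b. h t)"
proof -
  have "(\<Sum>i<k. LBINT t=x i..x (Suc i). h t) = (LBINT t=a..x k. h t)" if "k \<le> n" for k
    using that
  proof (induction k)
    case 0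
    then show ?case using x by (simp add: partition_points_def interval_integral_endpoints_same)
  next
    case (Suc k)
    have ord: "a \<le> x k" "x k \<le> x (Suc k)" "x (Suc k) \<le> b"
      using Suc.prems partition_points_bounds[OF x] partition_points_mono[OF x, of k "Suc k"] by auto
    have "set_integrable lborel (einterval a (x (Suc k))) h"
      by (rule set_integrable_subset[OF h]) (use ord in \<open>auto simp: einterval_def\<close>)
    with ord Suc show ?case
      by (simp, subst interval_integral_sum)
        (auto simp: interval_lebesgue_integrable_def min_def max_def)
  qed
  from this[of n] show ?thesis using x by (simp add: partition_points_def)
qed

text \<open>Closed subsets of the compact space \<open>ereal\<close> are compact, so the continuous
  image of \<open>[0, \<infinity>]\<close> is bounded.\<close>

lemma continuous_on_extended_half_line_bounded:
  fixes F :: "ereal \<Rightarrow> real"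
  assumes "continuous_on {0..\<infinity>} F"
  obtains M where "M > 0" "\<And>t. t \<ge> 0 \<Longrightarrow> \<bar>F t\<bar> \<le> M"
proof -
  have "bounded (F ` {0..\<infinity>})"
    by (intro compact_imp_bounded compact_continuous_image assms compact_eq_closed[THEN iffD2]) auto
  then show thesis
    using that by (auto simp: bounded_pos)
qed

lemma set_integrable_continuous_bounded_mult:
  fixes F :: "ereal \<Rightarrow> real" and h :: "real \<Rightarrow> 'a::{banach, second_countable_topology}"
  assumes F: "continuous_on {0..\<infinity>} F" and h: "set_integrable lborel {0<..} h"
  shows "set_integrable lborel {0<..} (\<lambda>t. F (ereal t) *\<^sub>R h t)"
proof -
  obtain M where M: "M > 0" "\<And>t. t \<ge> 0 \<Longrightarrow> \<bar>F t\<bar> \<le> M"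
    using continuous_on_extended_half_line_bounded[OF F] by blast
  have "continuous_on {0<..} (\<lambda>t. F (ereal t))"
    by (rule continuous_on_compose2[OF F]) (auto intro!: continuous_intros)
  then have 1: "(\<lambda>t. indicator {0<..} t *\<^sub>R F (ereal t)) \<in> borel_measurable borel"
    by (intro borel_measurable_continuous_on_indicator) auto
  have 2: "(\<lambda>t. indicator {0<..} t *\<^sub>R h t) \<in> borel_measurable borel"
    using borel_measurable_integrable[OF h[unfolded set_integrable_def]] by simp
  \<comment> \<open>Both factors carry the indicator, since measurability of each is available only
    on the half line; the product of the two indicators is again the indicator.\<close>
  have "(\<lambda>t. (indicator {0<..} t *\<^sub>R F (ereal t)) *\<^sub>R (indicator {0<..} t *\<^sub>R h t)) \<in> borel_measurable borel"
    using borel_measurable_scaleR[OF 1 2] .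
  also have "(\<lambda>t. (indicator {0<..} t *\<^sub>R F (ereal t)) *\<^sub>R (indicator {0<..} t *\<^sub>R h t))
      = (\<lambda>t. indicator {0<..} t *\<^sub>R F (ereal t) *\<^sub>R h t)"
    by (auto simp: indicator_def fun_eq_iff)
  finally have meas: "set_borel_measurable lborel {0<..} (\<lambda>t. F (ereal t) *\<^sub>R h t)"
    by (simp add: set_borel_measurable_def)
  have "set_integrable lborel {0<..} (\<lambda>t. M *\<^sub>R h t)"
    using h by simp
  then show ?thesis
    by (rule set_integrable_bound[OF _ meas])
      (use M in \<open>auto intro!: AE_I2 mult_right_mono\<close>)
qed

lemma einterval_0_PInfty: "einterval 0 \<infinity> = {0<..}"
  by (auto simp: einterval_def)

text \<open>The integrand may change from piece to piece because in the Riemann--Stieltjes error it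
  contains the tag value \<open>F (c i)\<close>.\<close>

lemma sum_abs_interval_integral_le:
  fixes h :: "nat \<Rightarrow> real \<Rightarrow> real" and k :: "real \<Rightarrow> real"
  assumes x: "partition_points a b n x" and k: "set_integrable lborel (einterval a b) k"
    and h: "\<And>i. i < n \<Longrightarrow> set_integrable lborel (einterval (x i) (x (Suc i))) (h i)"
    and le: "\<And>i t. i < n \<Longrightarrow> t \<in> einterval (x i) (x (Suc i)) \<Longrightarrow> \<bar>h i t\<bar> \<le> k t"
  shows "(\<Sum>i<n. \<bar>LBINT t=x i..x (Suc i). h i t\<bar>) \<le> (LBINT t=a..b. k t)"
proof -
  have "\<bar>LBINT t=x i..x (Suc i). h i t\<bar> \<le> (LBINT t=x i..x (Suc i). k t)" if "i < n" for i
  proof -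
    have ord: "x i \<le> x (Suc i)" "a \<le> x i" "x (Suc i) \<le> b"
      using that partition_points_bounds[OF x] partition_points_mono[OF x, of i "Suc i"] by auto
    have k': "set_integrable lborel (einterval (x i) (x (Suc i))) k"
      by (rule set_integrable_subset[OF k]) (use ord in \<open>auto simp: einterval_def\<close>)
    have "\<bar>LBINT t=x i..x (Suc i). h i t\<bar> \<le> (LBINT t=x i..x (Suc i). \<bar>h i t\<bar>)"
      using interval_integral_norm[of "x i" "x (Suc i)" "h i"] h[OF that] ord
      by (simp add: interval_lebesgue_integrable_def)
    also have "\<dots> \<le> (LBINT t=x i..x (Suc i). k t)"
      unfolding interval_lebesgue_integral_le_eq[OF ord(1)]
      by (intro set_integral_mono set_integrable_abs h k' le that)
    finally show ?thesis .
  qed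
  then have "(\<Sum>i<n. \<bar>LBINT t=x i..x (Suc i). h i t\<bar>) \<le> (\<Sum>i<n. LBINT t=x i..x (Suc i). k t)"
    by (intro sum_mono) auto
  also have "\<dots> = (LBINT t=a..b. k t)"
    by (rule interval_lebesgue_integral_partition[OF x k])
  finally show ?thesis .
qed

section \<open>Multipliers that are indefinite integrals\<close>

text \<open>The integral of \<open>\<bar>h\<bar>\<close> bounds the variation over every partition.
  Describing \<open>g\<close> by its increments rather than by a derivative covers
  \<open>v = \<infinity>\<close> as well.\<close>

lemma bounded_variation_of_integral:
  fixes g :: "ereal \<Rightarrow> real"
  assumes h: "set_integrable lborel {0<..} h"
    and g: "\<And>u v. 0 \<le> u \<Longrightarrow> u < v \<Longrightarrow> g v - g u = (LBINT t=u..v. h t)"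
  shows "bounded_variation_on_interval 0 \<infinity> g"
  unfolding bounded_variation_on_interval_def
proof (intro exI allI impI)
  fix n :: nat and x :: "nat \<Rightarrow> ereal"
  assume x: "partition_points 0 \<infinity> n x"
  have "(\<Sum>i<n. \<bar>g (x (Suc i)) - g (x i)\<bar>) = (\<Sum>i<n. \<bar>LBINT t=x i..x (Suc i). h t\<bar>)"
    using g x partition_points_bounds(1)[OF x] by (intro sum.cong) (auto simp: partition_points_def)
  also have "\<dots> \<le> (LBINT t=0..\<infinity>. \<bar>h t\<bar>)"
  proof (rule sum_abs_interval_integral_le[OF x])
    show "set_integrable lborel (einterval 0 \<infinity>) (\<lambda>t. \<bar>h t\<bar>)"
      unfolding einterval_0_PInfty by (intro set_integrable_abs h)
    fix i assume "i < n"
    with partition_points_bounds(1)[OF x, of i] show "set_integrable lborel (einterval (x i) (x (Suc i))) h"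
      by (intro set_integrable_subset[OF h]) (auto simp: einterval_def zero_ereal_def dest: le_less_trans)
  qed auto
  finally show "(\<Sum>i<n. \<bar>g (x (Suc i)) - g (x i)\<bar>) \<le> (LBINT t=0..\<infinity>. \<bar>h t\<bar>)" .
qed

lemma has_RS_integral_of_integral:
  fixes F g :: "ereal \<Rightarrow> real"
  assumes F: "continuous_on {0..\<infinity>} F" and h: "set_integrable lborel {0<..} h"
    and g: "\<And>u v. 0 \<le> u \<Longrightarrow> u < v \<Longrightarrow> g v - g u = (LBINT t=u..v. h t)"
  shows "has_RS_integral F g 0 \<infinity> (LBINT t:{0<..}. F (ereal t) * h t)"
  unfolding has_RS_integral_def
proof (intro allI impI)
  fix \<epsilon> :: real
  assume "\<epsilon> > 0"
  define V where "V = (LBINT t:{0<..}. \<bar>h t\<bar>)"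
  have "V \<ge> 0"
    unfolding V_def set_lebesgue_integral_def by (intro integral_nonneg_AE) auto
  \<comment> \<open>Dividing by \<open>V + 1\<close> instead of \<open>V\<close> is safe when
    \<open>V = 0\<close> and makes \<open>\<delta> * V\<close> strictly smaller than
    \<open>\<epsilon>\<close>.\<close>
  define \<delta> where "\<delta> = \<epsilon> / (V + 1)"
  have "\<delta> > 0" and \<delta>: "\<delta> * V < \<epsilon>"
    using \<open>\<epsilon> > 0\<close> \<open>V \<ge> 0\<close> by (auto simp: \<delta>_def field_simps)
  obtain m y where y: "partition_points 0 \<infinity> m y"
    and osc: "\<And>j s t. j < m \<Longrightarrow> s \<in> {y j..y (Suc j)} \<Longrightarrow> t \<in> {y j..y (Suc j)} \<Longrightarrow> \<bar>F s - F t\<bar> < \<delta>"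
    using small_oscillation_partition[OF F \<open>\<delta> > 0\<close>] by blast
  have Fh: "set_integrable lborel {0<..} (\<lambda>t. F (ereal t) * h t)"
    using set_integrable_continuous_bounded_mult[OF F h] by simp
  show "\<exists>m y. partition_points 0 \<infinity> m y \<and>
        (\<forall>n x c. partition_points 0 \<infinity> n x \<and> y ` {..m} \<subseteq> x ` {..n} \<and>
            (\<forall>i<n. c i \<in> {x i..x (Suc i)}) \<longrightarrow>
          \<bar>(\<Sum>i<n. F (c i) * (g (x (Suc i)) - g (x i))) - (LBINT t:{0<..}. F (ereal t) * h t)\<bar> < \<epsilon>)"
  proof (intro exI[of _ m] exI[of _ y] conjI y allI impI, elim conjE)
    fix n x c
    assume x: "partition_points 0 \<infinity> n x" and sub: "y ` {..m} \<subseteq> x ` {..n}"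
      and c: "\<forall>i<n. c i \<in> {x i..x (Suc i)}"
    have x_less: "x i < x (Suc i)" if "i < n" for i
      using x that by (simp add: partition_points_def)
    have x_pos: "0 \<le> x i" if "i < n" for i
      using partition_points_bounds(1)[OF x, of i] that by simp
    have sub_pos: "einterval (x i) (x (Suc i)) \<subseteq> {0<..}" if "i < n" for i
      using x_pos[OF that] by (auto simp: einterval_def zero_ereal_def dest: le_less_trans)
    have h_i: "set_integrable lborel (einterval (x i) (x (Suc i))) h"
      and Fh_i: "set_integrable lborel (einterval (x i) (x (Suc i))) (\<lambda>t. F (ereal t) * h t)" if "i < n" for i
      using set_integrable_subset[OF h _ sub_pos[OF that]] set_integrable_subset[OF Fh _ sub_pos[OF that]]
      by auto
    have c_h_i: "set_integrable lborel (einterval (x i) (x (Suc i))) (\<lambda>t. F (c i) * h t)" if "i < n" for i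
      using h_i[OF that] by (intro set_integrable_mult_right) simp
    have "(LBINT t:{0<..}. F (ereal t) * h t) = (LBINT t=0..\<infinity>. F (ereal t) * h t)"
      by (simp add: interval_lebesgue_integral_le_eq einterval_0_PInfty)
    also have "\<dots> = (\<Sum>i<n. LBINT t=x i..x (Suc i). F (ereal t) * h t)"
      using interval_lebesgue_integral_partition[OF x, of "\<lambda>t. F (ereal t) * h t"] Fh
      by (simp add: einterval_0_PInfty)
    finally have "(\<Sum>i<n. F (c i) * (g (x (Suc i)) - g (x i))) - (LBINT t:{0<..}. F (ereal t) * h t)
      = (\<Sum>i<n. F (c i) * (g (x (Suc i)) - g (x i)) - (LBINT t=x i..x (Suc i). F (ereal t) * h t))"
      by (simp add: sum_subtractf)
    \<comment> \<open>Each increment of \<open>g\<close> is the integral of \<open>h\<close> over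
      its piece, so the error is a sum of integrals of \<open>(F (c i) - F) * h\<close>.\<close>
    also have "\<dots> = (\<Sum>i<n. LBINT t=x i..x (Suc i). F (c i) * h t - F (ereal t) * h t)"
    proof (intro sum.cong refl)
      fix i assume "i \<in> {..<n}"
      then have i: "i < n" by simp
      show "F (c i) * (g (x (Suc i)) - g (x i)) - (LBINT t=x i..x (Suc i). F (ereal t) * h t)
        = (LBINT t=x i..x (Suc i). F (c i) * h t - F (ereal t) * h t)"
        using x_less[OF i] c_h_i[OF i] Fh_i[OF i] g[OF x_pos[OF i] x_less[OF i]]
        by (subst interval_lebesgue_integral_diff(2)) (auto simp: interval_lebesgue_integrable_def)
    qed
    finally have "\<bar>(\<Sum>i<n. F (c i) * (g (x (Suc i)) - g (x i))) - (LBINT t:{0<..}. F (ereal t) * h t)\<bar>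
        \<le> (\<Sum>i<n. \<bar>LBINT t=x i..x (Suc i). F (c i) * h t - F (ereal t) * h t\<bar>)"
      by simp
    also have "\<dots> \<le> (LBINT t=0..\<infinity>. \<delta> * \<bar>h t\<bar>)"
    proof (rule sum_abs_interval_integral_le[OF x])
      show "set_integrable lborel (einterval 0 \<infinity>) (\<lambda>t. \<delta> * \<bar>h t\<bar>)"
        unfolding einterval_0_PInfty by (intro set_integrable_mult_right set_integrable_abs h)
    next
      fix i assume "i < n"
      then show "set_integrable lborel (einterval (x i) (x (Suc i))) (\<lambda>t. F (c i) * h t - F (ereal t) * h t)"
        by (intro set_integral_diff(1) c_h_i Fh_i)
    next
      fix i t assume i: "i < n" and t: "t \<in> einterval (x i) (x (Suc i))"
      \<comment> \<open>The tag and \<open>t\<close> share a piece of \<open>x\<close>, hence also a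
        piece of \<open>y\<close>, where \<open>F\<close> oscillates by less than
        \<open>\<delta>\<close>.\<close>
      obtain j where j: "j < m" "y j \<le> x i" "x (Suc i) \<le> y (Suc j)"
        using partition_points_refinement_interval[OF y x sub i] .
      have "c i \<in> {y j..y (Suc j)}" "ereal t \<in> {y j..y (Suc j)}"
        using j t c i by (auto simp: einterval_def intro: order_trans dest: less_imp_le)
      then have "\<bar>F (c i) - F (ereal t)\<bar> \<le> \<delta>"
        using osc[OF j(1)] by (simp add: less_imp_le)
      then have "\<bar>F (c i) - F (ereal t)\<bar> * \<bar>h t\<bar> \<le> \<delta> * \<bar>h t\<bar>"
        by (intro mult_right_mono) auto
      then show "\<bar>F (c i) * h t - F (ereal t) * h t\<bar> \<le> \<delta> * \<bar>h t\<bar>"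
        by (simp add: abs_mult[symmetric] left_diff_distrib)
    qed
    also have "\<dots> = \<delta> * V"
      by (simp add: V_def interval_lebesgue_integral_le_eq einterval_0_PInfty)
    also have "\<dots> < \<epsilon>" by (rule \<delta>)
    finally show "\<bar>(\<Sum>i<n. F (c i) * (g (x (Suc i)) - g (x i))) - (LBINT t:{0<..}. F (ereal t) * h t)\<bar> < \<epsilon>" .
  qed
qed

section \<open>The integral against an antiderivative\<close>


lemma has_AC_integral_unique:
  assumes "has_AC_integral f g I" "has_AC_integral f g I'"
  shows "I = I'"
proof -
  have "J = J'" if "has_AC_integral_real f k J" "has_AC_integral_real f k J'" for k J J'
    using that has_RS_integral_unique unfolding has_AC_integral_real_def by blast
  then show ?thesis
    using assms unfolding has_AC_integral_def by (metis complex_eqI)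
qed

lemma AC_integral_eqI:
  assumes "has_AC_integral f g I"
  shows "AC_integral f g = I"
  unfolding AC_integral_def using assms has_AC_integral_unique by blast

lemma is_AC_primitive_AC_primitive:
  assumes "f \<in> AC_distributions"
  shows "is_AC_primitive f (AC_primitive f)"
  using assms someI_ex[of "is_AC_primitive f"] by (auto simp: AC_distributions_def AC_primitive_def)

text \<open>The fundamental theorem asks only for one-sided limits at the endpoints. At finite
  endpoints they come from continuity; at \<infinity> the extended value is the limit of
  \<open>G\<close>.\<close>

lemma extend_at_infinity_diff:
  fixes G h :: "real \<Rightarrow> complex"
  assumes G: "\<And>t. (G has_vector_derivative h t) (at t)" and cont: "\<And>t. isCont h t"
    and h: "set_integrable lborel {0<..} h" and lim: "(G \<longlongrightarrow> B) at_top"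
    and uv: "0 \<le> u" "u < v"
  shows "extend_at_infinity G v - extend_at_infinity G u = (LBINT t=u..v. h t)"
proof -
  obtain r where u: "u = ereal r" using uv by (cases u) auto
  have isCont: "isCont G t" for t
    using has_vector_derivative_continuous[OF G] .
  have "((G \<circ> real_of_ereal) \<longlongrightarrow> extend_at_infinity G u) (at_right u)"
    using isCont[of r] unfolding u ereal_tendsto_simps1
    by (auto simp: extend_at_infinity_def isCont_def intro: tendsto_mono[OF at_le])
  moreover have "((G \<circ> real_of_ereal) \<longlongrightarrow> extend_at_infinity G v) (at_left v)"
  proof (cases v)
    case (real s)
    then show ?thesis
      using isCont[of s] unfolding real ereal_tendsto_simps1
      by (auto simp: extend_at_infinity_def isCont_def intro: tendsto_mono[OF at_le])
  next
    case PInf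
    have "Lim at_top G = B" by (rule tendsto_Lim[OF _ lim]) simp
    with lim show ?thesis
      unfolding PInf infinity_ereal_def[symmetric] ereal_tendsto_simps1 by (simp add: extend_at_infinity_def)
  qed (use uv in auto)
  moreover have "set_integrable lborel (einterval u v) h"
    by (rule set_integrable_subset[OF h])
      (use uv in \<open>auto simp: einterval_def zero_ereal_def dest: le_less_trans\<close>)
  ultimately show ?thesis
    using interval_integral_FTC_integrable[OF \<open>u < v\<close> G cont] by simp
qed

lemma set_integrable_Re:
  assumes "set_integrable M A h" shows "set_integrable M A (\<lambda>t. Re (h t))"
  using integrable_Re[OF assms[unfolded set_integrable_def]] by (simp add: set_integrable_def)

lemma set_integrable_Im:
  assumes "set_integrable M A h" shows "set_integrable M A (\<lambda>t. Im (h t))"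
  using integrable_Im[OF assms[unfolded set_integrable_def]] by (simp add: set_integrable_def)

lemma set_integral_Re:
  assumes "set_integrable M A h" shows "Re (LINT t:A|M. h t) = (LINT t:A|M. Re (h t))"
  using integral_Re[OF assms[unfolded set_integrable_def]] by (simp add: set_lebesgue_integral_def)

lemma set_integral_Im:
  assumes "set_integrable M A h" shows "Im (LINT t:A|M. h t) = (LINT t:A|M. Im (h t))"
  using integral_Im[OF assms[unfolded set_integrable_def]] by (simp add: set_lebesgue_integral_def)

lemma has_AC_integral_real_of_integral:
  assumes f: "f \<in> AC_distributions" and h: "set_integrable lborel {0<..} h"
    and g: "\<And>u v. 0 \<le> u \<Longrightarrow> u < v \<Longrightarrow> g v - g u = (LBINT t=u..v. h t)"
  shows "has_AC_integral_real f g
    (AC_primitive f \<infinity> * g \<infinity> - (LBINT t:{0<..}. AC_primitive f (ereal t) * h t))"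
  using bounded_variation_of_integral[OF h g] has_RS_integral_of_integral[OF _ h g]
    is_AC_primitive_AC_primitive[OF f]
  unfolding has_AC_integral_real_def is_AC_primitive_def by blast

text \<open>This is the defining formula
  \<open>F(\<infinity>) g(\<infinity>) - \<integral> F dg\<close> with \<open>dg = h dt\<close>,
  established for real and imaginary parts separately.\<close>

lemma has_AC_integral_by_parts:
  fixes G h :: "real \<Rightarrow> complex"
  assumes f: "f \<in> AC_distributions"
    and G: "\<And>t. (G has_vector_derivative h t) (at t)" and cont: "\<And>t. isCont h t"
    and h: "set_integrable lborel {0<..} h" and lim: "(G \<longlongrightarrow> B) at_top"
  shows "has_AC_integral f (extend_at_infinity G)
    (AC_primitive f \<infinity> *\<^sub>R B - (LBINT t:{0<..}. AC_primitive f (ereal t) *\<^sub>R h t))"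
proof -
  let ?F = "AC_primitive f" and ?g = "extend_at_infinity G"
  have F: "continuous_on {0..\<infinity>} ?F"
    using is_AC_primitive_AC_primitive[OF f] by (simp add: is_AC_primitive_def)
  note Fh = set_integrable_continuous_bounded_mult[OF F h]
  have gB: "?g \<infinity> = B"
    using tendsto_Lim[OF _ lim] by (simp add: extend_at_infinity_def)
  have diff: "?g v - ?g u = (LINT t:einterval u v|lborel. h t)"
    "set_integrable lborel (einterval u v) h" if "0 \<le> u" "u < v" for u v
  proof -
    show "?g v - ?g u = (LINT t:einterval u v|lborel. h t)"
      using extend_at_infinity_diff[OF G cont h lim that] that
      by (simp add: interval_lebesgue_integral_le_eq)
    show "set_integrable lborel (einterval u v) h"
      by (rule set_integrable_subset[OF h])
        (use that in \<open>auto simp: einterval_def zero_ereal_def dest: le_less_trans\<close>)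
  qed
  have "has_AC_integral_real f (\<lambda>x. Re (?g x))
    (?F \<infinity> * Re (?g \<infinity>) - (LBINT t:{0<..}. ?F (ereal t) * Re (h t)))"
  proof (rule has_AC_integral_real_of_integral[OF f set_integrable_Re[OF h]])
    fix u v :: ereal assume "0 \<le> u" "u < v"
    then show "Re (?g v) - Re (?g u) = (LBINT t=u..v. Re (h t))"
      using diff[of u v] set_integral_Re[OF diff(2)]
      \<comment> \<open>The difference of real parts is folded into the real part of the difference,
        so that \<open>diff\<close> can rewrite it.\<close>
      by (simp add: interval_lebesgue_integral_le_eq minus_complex.sel(1)[symmetric] del: minus_complex.sel)
  qed
  moreover have "has_AC_integral_real f (\<lambda>x. Im (?g x))
    (?F \<infinity> * Im (?g \<infinity>) - (LBINT t:{0<..}. ?F (ereal t) * Im (h t)))"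
  proof (rule has_AC_integral_real_of_integral[OF f set_integrable_Im[OF h]])
    fix u v :: ereal assume "0 \<le> u" "u < v"
    then show "Im (?g v) - Im (?g u) = (LBINT t=u..v. Im (h t))"
      using diff[of u v] set_integral_Im[OF diff(2)]
      by (simp add: interval_lebesgue_integral_le_eq minus_complex.sel(2)[symmetric] del: minus_complex.sel)
  qed
  ultimately show ?thesis
    using set_integral_Re[OF Fh] set_integral_Im[OF Fh] by (simp add: has_AC_integral_def gB)
qed

section \<open>Integrability and decay of powers times exponentials\<close>

text \<open>This is the Gamma integral at \<open>n + 1\<close> with rate \<open>a\<close>: on the
  positive half line, the norm of its integrand is the function in question.\<close>

lemma integrable_power_times_exp:
  assumes "a > 0"
  shows "set_integrable lborel {0<..} (\<lambda>t::real. t ^ n * exp (- (a * t)))"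
proof -
  let ?g = "\<lambda>t. t ^ n * exp (- (a * t))"
  have "(\<lambda>t. complex_of_real t powr (of_nat (Suc n) - 1) / of_real (exp (a * t))) absolutely_integrable_on {0<..}"
    using assms by (intro absolutely_integrable_Gamma_integral) auto
  then have "set_integrable lebesgue {0<..} (\<lambda>t. norm (complex_of_real t powr (of_nat (Suc n) - 1) / of_real (exp (a * t))))"
    by (rule set_integrable_norm)
  also have "?this \<longleftrightarrow> set_integrable lebesgue {0<..} ?g"
  proof (rule set_integrable_cong)
    fix t :: real assume t: "t \<in> {0<..}"
    then have "complex_of_real t powr of_nat n = complex_of_real t ^ n"
      by (intro powr_nat') auto
    with t show "norm (complex_of_real t powr (of_nat (Suc n) - 1) / of_real (exp (a * t))) = ?g t"
      by (simp add: norm_mult norm_inverse norm_power exp_minus divide_inverse del: of_real_exp)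
  qed auto
  \<comment> \<open>\<open>lebesgue\<close> is the completion of \<open>lborel\<close>, so for a
    Borel function the two notions of integrability agree.\<close>
  finally show ?thesis
    unfolding set_integrable_def
    by (subst (asm) integrable_completion) (auto intro!: borel_measurable_continuous_onI continuous_intros)
qed

text \<open>Substitute \<open>s = a * t\<close> in the limit of \<open>s ^ n / exp s\<close>; the
  factor \<open>inverse (a ^ n)\<close> undoes the scaling of the power.\<close>

lemma tendsto_power_times_exp_0:
  assumes "a > 0"
  shows "((\<lambda>t::real. t ^ n * exp (- (a * t))) \<longlongrightarrow> 0) at_top"
proof -
  have "((\<lambda>t. (a * t) ^ n / exp (a * t)) \<longlongrightarrow> 0) at_top"
    by (rule filterlim_compose[OF tendsto_power_div_exp_0])
      (use assms in \<open>auto intro!: filterlim_tendsto_pos_mult_at_top[OF tendsto_const] filterlim_ident\<close>)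
  then have "((\<lambda>t. inverse (a ^ n) * ((a * t) ^ n / exp (a * t))) \<longlongrightarrow> inverse (a ^ n) * 0) at_top"
    by (intro tendsto_intros)
  moreover have "inverse (a ^ n) * ((a * t) ^ n / exp (a * t)) = t ^ n * exp (- (a * t))" for t
    using assms by (simp add: power_mult_distrib exp_minus field_simps)
  ultimately show ?thesis by simp
qed

section \<open>Laplace kernels\<close>

text \<open>Differentiation in \<open>z\<close> turns index \<open>n\<close> into minus index
  \<open>n + 1\<close>, so the family is closed under it up to sign. Since \<open>0 ^ 0 = 1\<close>,
  index 0 is the plain exponential at every \<open>t\<close>.\<close>

definition laplace_kernel :: "nat \<Rightarrow> complex \<Rightarrow> real \<Rightarrow> complex" where
  "laplace_kernel n z t = of_real t ^ n * exp (- z * of_real t)"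

lemma norm_laplace_kernel:
  assumes "t \<ge> 0"
  shows "norm (laplace_kernel n z t) = t ^ n * exp (- (Re z * t))"
  using assms by (simp add: laplace_kernel_def norm_mult norm_power)

lemma continuous_on_laplace_kernel: "continuous_on A (laplace_kernel n z)"
  unfolding laplace_kernel_def by (intro continuous_intros)

lemma set_integrable_laplace_kernel:
  assumes "Re z > 0"
  shows "set_integrable lborel {0<..} (laplace_kernel n z)"
proof (rule set_integrable_bound[OF integrable_power_times_exp[OF assms, of n]])
  show "set_borel_measurable lborel {0<..} (laplace_kernel n z)"
    using borel_measurable_continuous_on_indicator[OF _ continuous_on_laplace_kernel, of "{0<..}" n z]
    by (simp add: set_borel_measurable_def)
qed (auto intro!: AE_I2 simp: norm_laplace_kernel)

text \<open>For \<open>n = 0\<close> the truncated index \<open>n - 1\<close> is harmless, because its coefficient vanishes.\<close>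

lemma laplace_kernel_has_vector_derivative:
  "(laplace_kernel n z has_vector_derivative
     (of_nat n * laplace_kernel (n - 1) z t - z * laplace_kernel n z t)) (at t)"
proof -
  have "((\<lambda>w. w ^ n * exp (- z * w)) has_field_derivative
      (of_nat n * laplace_kernel (n - 1) z t - z * laplace_kernel n z t)) (at (complex_of_real t))"
    unfolding laplace_kernel_def by (auto intro!: derivative_eq_intros simp: algebra_simps)
  from has_vector_derivative_real_field[OF this] show ?thesis
    by (simp add: laplace_kernel_def[abs_def])
qed

lemma laplace_kernel_tendsto_0:
  assumes "Re z > 0"
  shows "(laplace_kernel n z \<longlongrightarrow> 0) at_top"
proof (rule Lim_null_comparison[OF _ tendsto_power_times_exp_0[OF assms]])
  show "\<forall>\<^sub>F t in at_top. norm (laplace_kernel n z t) \<le> t ^ n * exp (- (Re z * t))"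
    using eventually_ge_at_top[of 0] by eventually_elim (simp add: norm_laplace_kernel)
qed

section \<open>Differentiation under the integral sign\<close>

text \<open>Shifting \<open>z\<close> by \<open>h\<close> multiplies the kernel by
  \<open>exp u\<close> with \<open>u = - h * t\<close>, so the left side is the kernel times the
  Taylor remainder of \<open>exp\<close> after the linear term. The growth
  \<open>exp \<bar>Re u\<bar>\<close> uses up at most half of the decay rate
  \<open>Re z\<close>.\<close>

lemma laplace_kernel_remainder:
  assumes z: "Re z > 0" and h: "norm h \<le> Re z / 2" and t: "t \<ge> 0"
  shows "norm (laplace_kernel n (z + h) t - laplace_kernel n z t + h * laplace_kernel (Suc n) z t)
    \<le> (norm h)\<^sup>2 * (t ^ (n + 2) * exp (- (Re z / 2 * t)))"
proof -
  define u where "u = - h * of_real t"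
  \<comment> \<open>At order 1 the denominator in \<open>Taylor_exp\<close> is
    \<open>fact 1\<close>, hence the constant 1.\<close>
  have "norm (exp u - 1 - u) \<le> exp \<bar>Re u\<bar> * (norm u)\<^sup>2"
    using Taylor_exp[of u 1] by (simp add: diff_diff_eq power2_eq_square)
  also have "\<dots> \<le> exp (Re z / 2 * t) * (norm u)\<^sup>2"
  proof -
    have "\<bar>Re u\<bar> = \<bar>Re h\<bar> * t" using t by (simp add: u_def abs_mult)
    also have "\<dots> \<le> Re z / 2 * t"
      using abs_Re_le_cmod[of h] h t by (intro mult_right_mono) auto
    finally show ?thesis by (intro mult_right_mono) auto
  qed
  finally have u: "norm (exp u - 1 - u) \<le> exp (Re z / 2 * t) * (norm u)\<^sup>2" .
  have "exp (- (z + h) * of_real t) = exp (- z * of_real t) * exp u"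
    by (simp add: u_def exp_add[symmetric] algebra_simps)
  then have "laplace_kernel n (z + h) t - laplace_kernel n z t + h * laplace_kernel (Suc n) z t
    = laplace_kernel n z t * (exp u - 1 - u)"
    by (simp add: laplace_kernel_def algebra_simps) (simp add: u_def)
  also have "norm \<dots> \<le> (t ^ n * exp (- (Re z * t))) * (exp (Re z / 2 * t) * (norm u)\<^sup>2)"
    unfolding norm_mult norm_laplace_kernel[OF t] by (intro mult_left_mono u) (use t in auto)
  also have "\<dots> = (norm h)\<^sup>2 * (t ^ (n + 2) * (exp (- (Re z * t)) * exp (Re z / 2 * t)))"
    using t by (simp add: u_def norm_mult power_mult_distrib power_add power2_eq_square algebra_simps)
  also have "exp (- (Re z * t)) * exp (Re z / 2 * t) = exp (- (Re z / 2 * t))"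
    by (simp add: exp_add[symmetric])
  finally show ?thesis .
qed

text \<open>Dividing by \<open>norm h\<close> leaves an error of at most \<open>C * norm h\<close>.
  A quadratic bound survives integration, which makes this criterion suited to parameter
  integrals.\<close>

lemma has_field_derivative_quadratic_remainder:
  fixes L :: "'a::real_normed_field \<Rightarrow> 'a"
  assumes "\<delta> > 0" and le: "\<And>h. norm h \<le> \<delta> \<Longrightarrow> norm (L (z + h) - L z - h * D) \<le> C * (norm h)\<^sup>2"
  shows "(L has_field_derivative D) (at z)"
proof -
  have "((\<lambda>h. (L (z + h) - L z) / h - D) \<longlongrightarrow> 0) (at 0)"
  proof (rule Lim_null_comparison)
    have "\<forall>\<^sub>F h in at 0. h \<noteq> 0 \<and> norm h < \<delta>"
      using \<open>\<delta> > 0\<close> by (auto simp: eventually_at dist_norm)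
    then show "\<forall>\<^sub>F h in at 0. norm ((L (z + h) - L z) / h - D) \<le> C * norm h"
    proof eventually_elim
      case (elim h)
      then have "norm ((L (z + h) - L z) / h - D) = norm (L (z + h) - L z - h * D) / norm h"
        by (simp add: norm_divide[symmetric] field_simps)
      also have "\<dots> \<le> C * norm h"
        using le[of h] elim by (simp add: divide_le_eq power2_eq_square mult.assoc)
      finally show ?case .
    qed
    show "((\<lambda>h. C * norm h) \<longlongrightarrow> 0) (at (0::'a))"
      by (auto intro!: tendsto_eq_intros)
  qed
  then show ?thesis
    by (simp add: LIM_zero_iff DERIV_def)
qed

text \<open>The pointwise remainder bound, times a bound \<open>M\<close> for \<open>F\<close>, is
  integrated over \<open>t\<close>; the resulting constant does not depend on
  \<open>h\<close>.\<close>

lemma weighted_laplace_kernel_has_field_derivative: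
  fixes F :: "ereal \<Rightarrow> real"
  assumes F: "continuous_on {0..\<infinity>} F" and z: "Re z > 0"
  shows "((\<lambda>z. LBINT t:{0<..}. F (ereal t) *\<^sub>R laplace_kernel n z t) has_field_derivative
    - (LBINT t:{0<..}. F (ereal t) *\<^sub>R laplace_kernel (Suc n) z t)) (at z)"
proof -
  obtain M where M: "M > 0" "\<And>t. t \<ge> 0 \<Longrightarrow> \<bar>F t\<bar> \<le> M"
    using continuous_on_extended_half_line_bounded[OF F] by blast
  \<comment> \<open>This is the \<open>h\<close>-free factor in
    \<open>laplace_kernel_remainder\<close>, integrable because the halved rate is still
    positive.\<close>
  define e where "e t = t ^ (n + 2) * exp (- (Re z / 2 * t))" for t :: real
  have e: "set_integrable lborel {0<..} e"
    using integrable_power_times_exp[of "Re z / 2" "n + 2"] z by (simp add: e_def[abs_def])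
  define k where "k m w t = F (ereal t) *\<^sub>R laplace_kernel m w t" for m w t
  have k: "set_integrable lborel {0<..} (k m w)" if "Re w > 0" for m w
    using set_integrable_continuous_bounded_mult[OF F set_integrable_laplace_kernel[OF that]]
    by (simp add: k_def[abs_def])
  have "((\<lambda>z. LBINT t:{0<..}. k n z t) has_field_derivative - (LBINT t:{0<..}. k (Suc n) z t)) (at z)"
  proof (rule has_field_derivative_quadratic_remainder)
    show "Re z / 2 > 0" using z by simp
    fix h :: complex
    assume h: "norm h \<le> Re z / 2"
    \<comment> \<open>The radius \<open>Re z / 2\<close> keeps \<open>z + h\<close> in the half
      plane, where the kernels are integrable.\<close>
    then have "Re (z + h) > 0" using abs_Re_le_cmod[of h] z by simp
    note int = k[OF this, of n] k[OF z, of n] k[OF z, of "Suc n"]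
    have int': "set_integrable lborel {0<..} (\<lambda>t. h * k (Suc n) z t)"
      by (intro set_integrable_mult_right int(3))
    have int'': "set_integrable lborel {0<..} (\<lambda>t. k n (z + h) t - k n z t + h * k (Suc n) z t)"
      by (intro set_integral_add(1) set_integral_diff(1) int int')
    have "(LBINT t:{0<..}. k n (z + h) t) - (LBINT t:{0<..}. k n z t) - h * - (LBINT t:{0<..}. k (Suc n) z t)
      = (LBINT t:{0<..}. k n (z + h) t - k n z t + h * k (Suc n) z t)"
      using int int' by (simp add: set_integral_add(2) set_integral_diff)
    also have "norm \<dots> \<le> (LBINT t:{0<..}. norm (k n (z + h) t - k n z t + h * k (Suc n) z t))"
      by (rule set_integral_norm_bound[OF int''])
    also have "\<dots> \<le> (LBINT t:{0<..}. M * (norm h)\<^sup>2 * e t)"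
    proof (rule set_integral_mono[OF set_integrable_norm[OF int'']])
      show "set_integrable lborel {0<..} (\<lambda>t. M * (norm h)\<^sup>2 * e t)"
        by (intro set_integrable_mult_right e)
      fix t :: real assume "t \<in> {0<..}"
      then have t: "t \<ge> 0" by simp
      have "k n (z + h) t - k n z t + h * k (Suc n) z t = F (ereal t) *\<^sub>R
          (laplace_kernel n (z + h) t - laplace_kernel n z t + h * laplace_kernel (Suc n) z t)"
        by (simp add: k_def scaleR_add_right scaleR_diff_right)
      also have "norm \<dots> \<le> M * ((norm h)\<^sup>2 * e t)"
        unfolding norm_scaleR e_def
        using M(1) M(2)[of "ereal t"] t by (intro mult_mono laplace_kernel_remainder z h t) auto
      finally show "norm (k n (z + h) t - k n z t + h * k (Suc n) z t) \<le> M * (norm h)\<^sup>2 * e t"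
        by simp
    qed
    finally show "norm ((LBINT t:{0<..}. k n (z + h) t) - (LBINT t:{0<..}. k n z t)
        - h * - (LBINT t:{0<..}. k (Suc n) z t)) \<le> M * (LBINT t:{0<..}. e t) * (norm h)\<^sup>2"
      by (simp add: mult_ac)
  qed
  then show ?thesis by (simp add: k_def)
qed

section \<open>Laplace integrals of a distribution and their derivatives\<close>

text \<open>Integration by parts with the \<open>t\<close>-derivative of the kernel; the boundary
  term vanishes because the kernel tends to 0 at \<infinity>. It rewrites the integral through
  functions whose \<open>z\<close>-derivatives are known.\<close>

lemma has_AC_integral_laplace_kernel:
  assumes f: "f \<in> AC_distributions" and z: "Re z > 0"
  shows "has_AC_integral f (extend_at_infinity (laplace_kernel n z))
    (z * (LBINT t:{0<..}. AC_primitive f (ereal t) *\<^sub>R laplace_kernel n z t)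
     - of_nat n * (LBINT t:{0<..}. AC_primitive f (ereal t) *\<^sub>R laplace_kernel (n - 1) z t))"
proof -
  let ?F = "AC_primitive f"
  let ?h = "\<lambda>t. of_nat n * laplace_kernel (n - 1) z t - z * laplace_kernel n z t"
  have F: "continuous_on {0..\<infinity>} ?F"
    using is_AC_primitive_AC_primitive[OF f] by (simp add: is_AC_primitive_def)
  have int: "set_integrable lborel {0<..} (\<lambda>t. c * laplace_kernel m z t)" for c m
    using set_integrable_laplace_kernel[OF z] by (intro set_integrable_mult_right)
  have "isCont ?h t" for t
    using continuous_on_laplace_kernel[of UNIV] by (auto intro!: continuous_intros simp: continuous_on_eq_continuous_at)
  from has_AC_integral_by_parts[OF f laplace_kernel_has_vector_derivative this
      set_integral_diff(1)[OF int int] laplace_kernel_tendsto_0[OF z]]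
  have "has_AC_integral f (extend_at_infinity (laplace_kernel n z)) (- (LBINT t:{0<..}. ?F (ereal t) *\<^sub>R ?h t))"
    by simp
  also have "(LBINT t:{0<..}. ?F (ereal t) *\<^sub>R ?h t)
    = of_nat n * (LBINT t:{0<..}. ?F (ereal t) *\<^sub>R laplace_kernel (n - 1) z t)
      - z * (LBINT t:{0<..}. ?F (ereal t) *\<^sub>R laplace_kernel n z t)"
    using set_integrable_continuous_bounded_mult[OF F int]
    by (simp add: scaleR_diff_right set_integral_diff mult_scaleR_right[symmetric] del: mult_scaleR_right)
  finally show ?thesis by simp
qed

lemma AC_integral_laplace_kernel_has_field_derivative:
  assumes f: "f \<in> AC_distributions" and z: "Re z > 0"
  shows "((\<lambda>z. AC_integral f (extend_at_infinity (laplace_kernel n z))) has_field_derivative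
    - AC_integral f (extend_at_infinity (laplace_kernel (Suc n) z))) (at z)"
proof -
  define L where "L m w = (LBINT t:{0<..}. AC_primitive f (ereal t) *\<^sub>R laplace_kernel m w t)" for m w
  have eq: "AC_integral f (extend_at_infinity (laplace_kernel m w)) = w * L m w - of_nat m * L (m - 1) w"
    if "Re w > 0" for m w
    using AC_integral_eqI[OF has_AC_integral_laplace_kernel[OF f that]] by (simp add: L_def)
  have L: "(L m has_field_derivative - L (Suc m) z) (at z)" for m
    using weighted_laplace_kernel_has_field_derivative[OF _ z] is_AC_primitive_AC_primitive[OF f]
    by (simp add: L_def[abs_def] is_AC_primitive_def)
  \<comment> \<open>Differentiating \<open>L (n - 1)\<close> produces index
    \<open>Suc (n - 1)\<close>. For \<open>n = 0\<close> this is 1 instead of \<open>n\<close>, but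
    then both sides are 0.\<close>
  have "of_nat n * L (Suc (n - 1)) z = of_nat n * L n z" by (cases n) auto
  then have "((\<lambda>w. w * L n w - of_nat n * L (n - 1) w) has_field_derivative
      - (z * L (Suc n) z - of_nat (Suc n) * L n z)) (at z)"
    by (auto intro!: derivative_eq_intros L simp: algebra_simps)
  then have "((\<lambda>w. w * L n w - of_nat n * L (n - 1) w) has_field_derivative
      - AC_integral f (extend_at_infinity (laplace_kernel (Suc n) z))) (at z)"
    using eq[OF z, of "Suc n"] by simp
  \<comment> \<open>The formula \<open>eq\<close> holds only in the half plane; its openness lets
    the derivative pass to the integral itself.\<close>
  moreover have "open {w. Re w > 0}" by (rule open_halfspace_Re_gt)
  ultimately show ?thesis
    by (rule has_field_derivative_transform_within_open) (use z eq in auto)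
qed

lemma deriv_laplace_transform:
  assumes f: "f \<in> AC_distributions" and "Re z > 0"
  shows "(deriv ^^ n) (laplace_transform f) z =
    (-1) ^ n * AC_integral f (extend_at_infinity (laplace_kernel n z))"
  using assms(2)
proof (induction n arbitrary: z)
  case 0
  then show ?case by (simp add: laplace_transform_def laplace_kernel_def[abs_def])
next
  case (Suc n)
  \<comment> \<open>\<open>deriv\<close> depends on the values near \<open>z\<close>, so the
    induction hypothesis is used on a whole neighbourhood.\<close>
  have "\<forall>\<^sub>F w in nhds z. (deriv ^^ n) (laplace_transform f) w =
      (-1) ^ n * AC_integral f (extend_at_infinity (laplace_kernel n w))"
    using eventually_nhds_in_open[OF open_halfspace_Re_gt[of 0], of z] Suc
    by (auto elim!: eventually_mono)
  then have "deriv ((deriv ^^ n) (laplace_transform f)) z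
      = deriv (\<lambda>w. (-1) ^ n * AC_integral f (extend_at_infinity (laplace_kernel n w))) z"
    by (rule deriv_cong_ev) simp
  also have "\<dots> = (-1) ^ n * - AC_integral f (extend_at_infinity (laplace_kernel (Suc n) z))"
    by (intro DERIV_imp_deriv DERIV_cmult AC_integral_laplace_kernel_has_field_derivative f Suc)
  finally show ?case by simp
qed

text \<open>\<open>deriv\<close> is a total operator, so an equation for its iterates does not
  assert differentiability. That comes from the integral on the other side of the equation.\<close>

lemma holomorphic_deriv_laplace_transform:
  assumes f: "f \<in> AC_distributions"
  shows "(deriv ^^ n) (laplace_transform f) holomorphic_on {z. Re z > 0}"
proof -
  have "(\<lambda>z. (-1) ^ n * AC_integral f (extend_at_infinity (laplace_kernel n z))) holomorphic_on {z. Re z > 0}"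
    using AC_integral_laplace_kernel_has_field_derivative[OF f]
    by (intro holomorphic_intros) (auto simp: holomorphic_on_open open_halfspace_Re_gt)
  then show ?thesis
    by (rule holomorphic_transform) (simp add: deriv_laplace_transform[OF f])
qed

theorem mainTheorem12:
  fixes f :: "(real \<Rightarrow> real) \<Rightarrow> real"
  assumes "f \<in> AC_distributions"
  shows "(\<forall>z::complex. Re z > 0 \<or> z = 0 \<longrightarrow>
           AC_integrable f (extend_at_infinity (\<lambda>t. exp (- z * of_real t)))) \<and>
         (\<forall>n::nat. (deriv ^^ n) (laplace_transform f) holomorphic_on {z. Re z > 0}) \<and>
         (\<forall>(n::nat) (z::complex). Re z > 0 \<longrightarrow>
           AC_integrable f (extend_at_infinity (\<lambda>t. of_real t ^ n * exp (- z * of_real t))) \<and>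
           (deriv ^^ n) (laplace_transform f) z =
             (-1) ^ n * AC_integral f (extend_at_infinity (\<lambda>t. of_real t ^ n * exp (- z * of_real t))))"
proof -
  have pos: "AC_integrable f (extend_at_infinity (laplace_kernel n z))" if "Re z > 0" for n z
    using has_AC_integral_laplace_kernel[OF assms that] by (auto simp: AC_integrable_def)
  \<comment> \<open>At \<open>z = 0\<close>, outside the half plane, the multiplier is the constant
    1: its derivative is 0 and its limit is 1, so integration by parts still applies.\<close>
  have zero: "AC_integrable f (extend_at_infinity (\<lambda>t. 1))"
    using has_AC_integral_by_parts[OF assms, of "\<lambda>t. 1" "\<lambda>t. 0" 1]
    by (auto simp: AC_integrable_def set_integrable_def)
  have "AC_integrable f (extend_at_infinity (\<lambda>t. exp (- z * of_real t)))" if "Re z > 0 \<or> z = 0" for z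
    using that pos[of z 0] zero by (auto simp: laplace_kernel_def[abs_def])
  then show ?thesis
    using pos deriv_laplace_transform[OF assms] holomorphic_deriv_laplace_transform[OF assms]
    by (simp add: laplace_kernel_def[abs_def])
qed

end
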